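(* Let $S$ be a generalized Krull domain with $\dim S>1$ such that the set of units of $S$ along with $0$ forms a field $k$. Let $J$ be a principal height one prime ideal of $S$ that is not a maximal ideal of $S$. Suppose further that all units of $S/J$ are in the image of $k$ (this image is also denoted $k$). If $R$ is the pullback of $k\to S/J\leftarrow S$, i.e. $R=k\times_{S/J}S=\{s\in S:\ s+J\in k\}$, then $R$ is perinormal.
   Context: All rings are commutative with identity; "local" means having a unique maximal ideal (no Noetherian assumption). Generalized Krull domain: for a ring $R$ let $\operatorname{Spec}^1(R)$ be the set of height one primes. An integral domain $R$ is a generalized Krull domain if (1) $R=\bigcap_{\mathfrak p\in\operatorname{Spec}^1(R)}R_{\mathfrak p}$; (2) for each nonzero $r\in R$ the set $\{\mathfrak p\in\operatorname{Spec}^1(R): r\in\mathfrak p\}$ is finite; (3) $R_{\mathfrak p}$ is a (not necessarily discrete) valuation domain for every $\mathfrak p\in\operatorname{Spec}^1(R)$. Perinormality: an overring of an integral domain $R$ is a ring between $R$ and its fraction field. An extension $R\subseteq T$ satisfies going-down if whenever $\mathfrak p_1\subseteq\mathfrak p_2$ are primes of $R$ and $Q_2\in\operatorname{Spec}T$ satisfies $Q_2\cap R=\mathfrak p_2$, there is $Q_1\in\operatorname{Spec}T$ with $Q_1\subseteq Q_2$ and $Q_1\cap R=\mathfrak p_1$. An integral domain $R$ is perinormal if every local overring $L$ of $R$ such that $R\subseteq L$ satisfies going-down is a localization of $R$ (i.e. $L=R_{\mathfrak p}$ for some $\mathfrak p\in\operatorname{Spec}R$). *)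

theory Defs
  imports "HOL-Algebra.Algebra" "HOL-Library.Extended_Nat"
begin

text \<open>
  Integral domains are represented as subrings \<open>A\<close> of a field \<open>K\<close>. Up to isomorphism this
  covers all integral domains, since every domain is a subring of its fraction field; \<open>K\<close> may be
  larger than the fraction field of \<open>A\<close>. The ring structure on \<open>A\<close> is
  \<open>K\<lparr>carrier := A\<rparr>\<close>, and fraction field, localizations and overrings of \<open>A\<close> are formed
  inside \<open>K\<close>.
\<close>

definition prime_height :: "('a, 'm) ring_scheme \<Rightarrow> 'a set \<Rightarrow> enat" where
  "prime_height A P =
     Sup {enat n | n. \<exists>c :: nat \<Rightarrow> 'a set.
            (\<forall>i\<le>n. primeideal (c i) A) \<and> (\<forall>i<n. c i \<subset> c (Suc i)) \<and> c n = P}"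

definition krull_dim :: "('a, 'm) ring_scheme \<Rightarrow> enat" where
  "krull_dim A = Sup {prime_height A P | P. primeideal P A}"

definition Spec1 :: "('a, 'm) ring_scheme \<Rightarrow> 'a set set" where
  "Spec1 A = {P. primeideal P A \<and> prime_height A P = 1}"

definition local_ring :: "('a, 'm) ring_scheme \<Rightarrow> bool" where
  "local_ring A \<longleftrightarrow> cring A \<and> (\<exists>!M. maximalideal M A)"

definition going_down :: "('a, 'm) ring_scheme \<Rightarrow> ('a, 'n) ring_scheme \<Rightarrow> bool" where
  "going_down A B \<longleftrightarrow>
     (\<forall>P1 P2 Q2. primeideal P1 A \<longrightarrow> primeideal P2 A \<longrightarrow> P1 \<subseteq> P2 \<longrightarrow>
        primeideal Q2 B \<longrightarrow> Q2 \<inter> carrier A = P2 \<longrightarrow>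
        (\<exists>Q1. primeideal Q1 B \<and> Q1 \<subseteq> Q2 \<and> Q1 \<inter> carrier A = P1))"

definition frac_field :: "('a, 'm) ring_scheme \<Rightarrow> 'a set \<Rightarrow> 'a set" where
  "frac_field K A = {a \<otimes>\<^bsub>K\<^esub> inv\<^bsub>K\<^esub> b | a b. a \<in> A \<and> b \<in> A - {\<zero>\<^bsub>K\<^esub>}}"

definition localization_at :: "('a, 'm) ring_scheme \<Rightarrow> 'a set \<Rightarrow> 'a set \<Rightarrow> 'a set" where
  "localization_at K A P = {a \<otimes>\<^bsub>K\<^esub> inv\<^bsub>K\<^esub> s | a s. a \<in> A \<and> s \<in> A - P}"

definition overring :: "('a, 'm) ring_scheme \<Rightarrow> 'a set \<Rightarrow> 'a set \<Rightarrow> bool" where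
  "overring K A T \<longleftrightarrow> subring T K \<and> A \<subseteq> T \<and> T \<subseteq> frac_field K A"

definition valuation_domain :: "('a, 'm) ring_scheme \<Rightarrow> 'a set \<Rightarrow> bool" where
  "valuation_domain K V \<longleftrightarrow> subring V K \<and>
     (\<forall>x \<in> frac_field K V - {\<zero>\<^bsub>K\<^esub>}. x \<in> V \<or> inv\<^bsub>K\<^esub> x \<in> V)"

text \<open>
  The intersection of localizations is taken within the fraction field, so that an empty
  intersection is the fraction field itself.
\<close>

definition generalized_krull_domain :: "('a, 'm) ring_scheme \<Rightarrow> 'a set \<Rightarrow> bool" where
  "generalized_krull_domain K A \<longleftrightarrow> subring A K \<and>
     A = {x \<in> frac_field K A. \<forall>P \<in> Spec1 (K\<lparr>carrier := A\<rparr>). x \<in> localization_at K A P} \<and>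
     (\<forall>r \<in> A - {\<zero>\<^bsub>K\<^esub>}. finite {P \<in> Spec1 (K\<lparr>carrier := A\<rparr>). r \<in> P}) \<and>
     (\<forall>P \<in> Spec1 (K\<lparr>carrier := A\<rparr>). valuation_domain K (localization_at K A P))"

definition perinormal :: "('a, 'm) ring_scheme \<Rightarrow> 'a set \<Rightarrow> bool" where
  "perinormal K A \<longleftrightarrow> subring A K \<and>
     (\<forall>L. overring K A L \<longrightarrow> local_ring (K\<lparr>carrier := L\<rparr>) \<longrightarrow>
          going_down (K\<lparr>carrier := A\<rparr>) (K\<lparr>carrier := L\<rparr>) \<longrightarrow>
          (\<exists>P. primeideal P (K\<lparr>carrier := A\<rparr>) \<and> L = localization_at K A P))"

end

theory Submission
  imports Defs
begin

text \<open>
  Let \<open>L\<close> be a local overring of \<open>R\<close> with going-down, \<open>m\<close> its maximal ideal, \<open>p = m \<inter> R\<close>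
  and \<open>J = tS\<close>. If \<open>P \<noteq> J\<close> is a height one prime of \<open>S\<close> with \<open>P \<inter> R \<subseteq> p\<close>, then a prime of \<open>L\<close>
  below \<open>m\<close> lies over \<open>P \<inter> R\<close>, and since \<open>S\<^sub>P\<close> is a rank one valuation ring this forces
  \<open>L \<subseteq> S\<^sub>P\<close> and \<open>P \<inter> L \<subseteq> m\<close>. Every other height one prime, except possibly \<open>J\<close>, meets
  \<open>R - p\<close>, so by the finiteness condition the denominator of an element of \<open>L\<close> with respect to
  these primes is cleared by an element of \<open>R - p\<close>.
  If \<open>J\<close> is not contained in \<open>p\<close>, a further factor from \<open>J - p\<close> moves the product into \<open>J \<subseteq> R\<close>.
  Otherwise \<open>p = J\<close>. An element \<open>y\<close> of \<open>L \<inter> S\<close> outside \<open>m\<close> and \<open>J\<close> is then a unit modulo \<open>J\<close>,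
  because all height one primes containing it meet \<open>R - J\<close>; hence \<open>y \<in> R\<close>. Applied to \<open>y\<close> or
  \<open>1 + y\<close> this gives \<open>L \<inter> S = R\<close>. Finally a pole along \<open>J\<close> is impossible: if \<open>y \<in> L\<close> and \<open>n > 0\<close>
  is minimal with \<open>t\<^sup>n y \<in> S\<close>, then \<open>t\<^sup>n y \<in> m \<inter> R = J = tS\<close>, contradicting minimality.
\<close>

section \<open>Ideals avoiding a multiplicative set\<close>

text \<open>By Zorn's lemma. \<open>M\<close> is an arbitrary set, so that the result yields maximal
  ideals for \<open>M = {\<one>}\<close> and prime ideals for multiplicative
  \<open>M\<close>.\<close>

lemma (in ring) exists_ideal_maximal_avoiding:
  assumes "ideal I R" and "I \<inter> M = {}"
  obtains P where "ideal P R" "I \<subseteq> P" "P \<inter> M = {}"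
    "\<And>Q. ideal Q R \<Longrightarrow> P \<subseteq> Q \<Longrightarrow> Q \<inter> M = {} \<Longrightarrow> Q = P"
proof -
  let ?A = "{Q. ideal Q R \<and> I \<subseteq> Q \<and> Q \<inter> M = {}}"
  have "\<exists>P\<in>?A. \<forall>Q\<in>?A. P \<subseteq> Q \<longrightarrow> Q = P"
  proof (rule subset_Zorn_nonempty)
    show "?A \<noteq> {}" using assms by blast
    fix C assume C: "C \<noteq> {}" "subset.chain ?A C"
    have "subset.chain {I. ideal I R} C"
      using C(2) unfolding pred_on.chain_def by blast
    from chain_Union_is_ideal[OF this] C(1) have "ideal (\<Union>C) R" by simp
    thus "\<Union>C \<in> ?A" using C unfolding pred_on.chain_def by blast
  qed
  then obtain P where P: "P \<in> ?A" "\<forall>Q\<in>?A. P \<subseteq> Q \<longrightarrow> Q = P" by blast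
  show thesis
    by (rule that[of P]) (use P in blast)+
qed

text \<open>For an ideal, being proper means avoiding \<open>{\<one>}\<close>.\<close>

lemma (in ring) exists_maximalideal:
  assumes "ideal I R" and "\<one> \<notin> I"
  obtains P where "maximalideal P R" "I \<subseteq> P"
proof -
  obtain P where P: "ideal P R" "I \<subseteq> P" "P \<inter> {\<one>} = {}"
    "\<And>Q. ideal Q R \<Longrightarrow> P \<subseteq> Q \<Longrightarrow> Q \<inter> {\<one>} = {} \<Longrightarrow> Q = P"
    using exists_ideal_maximal_avoiding[OF assms(1), of "{\<one>}"] assms(2) by blast
  have "maximalideal P R"
  proof (rule maximalidealI[OF P(1)])
    show "carrier R \<noteq> P" using P(3) by auto
    fix J assume "ideal J R" "P \<subseteq> J" "J \<subseteq> carrier R"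
    thus "J = P \<or> J = carrier R"
      using P(4)[of J] ideal.one_imp_carrier[of J R] by blast
  qed
  thus thesis using that P(2) by blast
qed

text \<open>An ideal \<open>P\<close> maximal among those avoiding \<open>M\<close> is prime: for
  \<open>a\<close> and \<open>b\<close> outside \<open>P\<close>, both \<open>P + (a)\<close> and
  \<open>P + (b)\<close> meet \<open>M\<close>. The product of two such elements is in
  \<open>M\<close>, and it would be in \<open>P\<close> if \<open>a \<otimes> b\<close>
  were.\<close>

lemma (in cring) exists_primeideal_avoiding:
  assumes I: "ideal I R" "I \<inter> M = {}"
    and M: "\<one> \<in> M" "M \<subseteq> carrier R" "\<And>x y. x \<in> M \<Longrightarrow> y \<in> M \<Longrightarrow> x \<otimes> y \<in> M"
  obtains P where "primeideal P R" "I \<subseteq> P" "P \<inter> M = {}"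
proof -
  obtain P where P: "ideal P R" "I \<subseteq> P" "P \<inter> M = {}"
    "\<And>Q. ideal Q R \<Longrightarrow> P \<subseteq> Q \<Longrightarrow> Q \<inter> M = {} \<Longrightarrow> Q = P"
    using exists_ideal_maximal_avoiding[OF I] by metis
  interpret P: ideal P R by fact
  have meet: "\<exists>p\<in>P. \<exists>r\<in>carrier R. p \<oplus> r \<otimes> a \<in> M" if a: "a \<in> carrier R" "a \<notin> P" for a
  proof (rule ccontr)
    assume *: "\<not> ?thesis"
    have "ideal (P <+> PIdl a) R"
      by (rule add_ideals[OF P(1) cgenideal_ideal[OF a(1)]])
    moreover have "P \<subseteq> P <+> PIdl a"
    proof
      fix x assume "x \<in> P"
      hence "x = x \<oplus> \<zero> \<otimes> a" using a P.Icarr by simp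
      thus "x \<in> P <+> PIdl a"
        using \<open>x \<in> P\<close> unfolding set_add_def' cgenideal_def by blast
    qed
    moreover have "(P <+> PIdl a) \<inter> M = {}"
      using * unfolding set_add_def' cgenideal_def by blast
    ultimately have "P <+> PIdl a = P" by (rule P(4))
    moreover have "a \<in> P <+> PIdl a"
    proof -
      have "a = \<zero> \<oplus> \<one> \<otimes> a" using a by simp
      thus ?thesis
        using P.zero_closed unfolding set_add_def' cgenideal_def by blast
    qed
    ultimately show False using a by simp
  qed
  have "primeideal P R"
  proof (rule primeidealI[OF P(1) is_cring])
    show "carrier R \<noteq> P" using P(3) M(1) by auto
    fix a b assume ab: "a \<in> carrier R" "b \<in> carrier R" "a \<otimes> b \<in> P"
    show "a \<in> P \<or> b \<in> P"
    proof (rule ccontr)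
      assume "\<not> ?thesis"
      then obtain p r q s where pr: "p \<in> P" "r \<in> carrier R" "p \<oplus> r \<otimes> a \<in> M"
        and qs: "q \<in> P" "s \<in> carrier R" "q \<oplus> s \<otimes> b \<in> M"
        using meet[of a] meet[of b] ab by blast
      have c: "p \<in> carrier R" "q \<in> carrier R" using pr qs P.Icarr by auto
      \<comment> \<open>Every term of the expansion contains \<open>p\<close>, \<open>q\<close> or
        \<open>a \<otimes> b\<close>, all of them in \<open>P\<close>.\<close>
      have "(p \<oplus> r \<otimes> a) \<otimes> (q \<oplus> s \<otimes> b)
          = p \<otimes> (q \<oplus> s \<otimes> b) \<oplus> ((r \<otimes> a) \<otimes> q \<oplus> (r \<otimes> s) \<otimes> (a \<otimes> b))"
        using c pr(2) qs(2) ab(1,2) by algebra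
      also have "\<dots> \<in> P"
      proof (intro P.a_closed)
        show "p \<otimes> (q \<oplus> s \<otimes> b) \<in> P" by (rule P.I_r_closed) (use c pr qs ab in auto)
        show "r \<otimes> a \<otimes> q \<in> P" by (rule P.I_l_closed) (use c pr qs ab in auto)
        show "r \<otimes> s \<otimes> (a \<otimes> b) \<in> P" by (rule P.I_l_closed) (use c pr qs ab in auto)
      qed
      finally show False using M(3)[OF pr(3) qs(3)] P(3) by blast
    qed
  qed
  thus thesis using that P(2,3) by blast
qed

section \<open>Height one primes\<close>

text \<open>Height one excludes two situations: for \<open>P = {\<zero>}\<close> all chains ending
  in \<open>P\<close> have length 0, and a prime strictly between \<open>{\<zero>}\<close> and
  \<open>P\<close> gives a chain of length 2.\<close>

lemma (in domain) Spec1D: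
  assumes P: "P \<in> Spec1 R"
  shows "primeideal P R" and "P \<noteq> {\<zero>}"
    and "\<And>Q. primeideal Q R \<Longrightarrow> Q \<subseteq> P \<Longrightarrow> Q = {\<zero>} \<or> Q = P"
proof -
  let ?chain = "\<lambda>n (c::nat \<Rightarrow> 'a set).
    (\<forall>i\<le>n. primeideal (c i) R) \<and> (\<forall>i<n. c i \<subset> c (Suc i)) \<and> c n = P"
  have h: "Sup {enat n | n. \<exists>c. ?chain n c} = 1"
    using P unfolding Spec1_def prime_height_def by simp
  show prime: "primeideal P R" using P unfolding Spec1_def by simp
  have zero_mem: "\<zero> \<in> Q" if "primeideal Q R" for Q
    using that by (simp add: additive_subgroup.zero_closed ideal.axioms(1) primeideal.axioms(1))
  show "P \<noteq> {\<zero>}"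
  proof
    assume "P = {\<zero>}"
    have "n = 0" if "?chain n c" for n c
    proof (rule ccontr)
      assume "n \<noteq> 0"
      then obtain l where "n = Suc l" by (cases n) auto
      hence "c l \<subset> P" "\<zero> \<in> c l" using that zero_mem by auto
      thus False using \<open>P = {\<zero>}\<close> by auto
    qed
    hence "Sup {enat n | n. \<exists>c. ?chain n c} \<le> 0"
      by (intro Sup_least) (auto simp: zero_enat_def)
    thus False using h by simp
  qed
  fix Q assume Q: "primeideal Q R" "Q \<subseteq> P"
  show "Q = {\<zero>} \<or> Q = P"
  proof (rule ccontr)
    assume neq: "\<not> ?thesis"
    \<comment> \<open>The chain \<open>{\<zero>} \<subset> Q \<subset> P\<close>; indices above 2
      are only padding.\<close>
    define c where "c i = (if i = 0 then {\<zero>} else if i = 1 then Q else P)" for i :: nat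
    have "{\<zero>} \<subset> Q" "Q \<subset> P" using neq zero_mem[OF Q(1)] Q(2) by auto
    hence "?chain 2 c"
      using zeroprimeideal Q(1) prime by (auto simp: c_def numeral_2_eq_2 less_Suc_eq)
    hence "enat 2 \<le> Sup {enat n | n. \<exists>c. ?chain n c}"
      by (intro Sup_upper) blast
    thus False using h by (simp add: one_enat_def)
  qed
qed

text \<open>In the localization at \<open>P\<close> the maximal ideal is the only nonzero prime, so
  \<open>a\<close> lies in the radical of the ideal generated by \<open>q\<close>. The equation is
  this fact with denominators cleared.\<close>

lemma (in domain) Spec1_power_multiple:
  assumes P: "P \<in> Spec1 R" and q: "q \<in> P" "q \<noteq> \<zero>" and a: "a \<in> P"
  obtains n :: nat and u s where "u \<in> carrier R - P" "s \<in> carrier R" "a [^] n \<otimes> u = q \<otimes> s"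
proof -
  interpret P: primeideal P R using Spec1D(1)[OF P] .
  have c: "a \<in> carrier R" "q \<in> carrier R" using a q P.Icarr by auto
  let ?M = "{a [^] n \<otimes> u | (n::nat) u. u \<in> carrier R - P}"
  have one: "\<one> \<in> carrier R - P"
    using P.I_notcarr P.one_imp_carrier by auto
  have "PIdl q \<inter> ?M \<noteq> {}"
  proof
    assume empty: "PIdl q \<inter> ?M = {}"
    obtain Q where Q: "primeideal Q R" "PIdl q \<subseteq> Q" "Q \<inter> ?M = {}"
    proof (rule exists_primeideal_avoiding[OF cgenideal_ideal[OF c(2)] empty])
      show "\<one> \<in> ?M" using one by (intro CollectI exI[of _ 0] exI[of _ \<one>]) auto
      show "?M \<subseteq> carrier R" using c by auto
    next
      fix x y assume "x \<in> ?M" "y \<in> ?M"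
      then obtain n u l v where xy: "x = a [^] (n::nat) \<otimes> u" "y = a [^] (l::nat) \<otimes> v"
        and uv: "u \<in> carrier R - P" "v \<in> carrier R - P" by blast
      have "x \<otimes> y = a [^] (n + l) \<otimes> (u \<otimes> v)"
        using uv c by (simp add: xy nat_pow_mult[symmetric] m_ac)
      moreover have "u \<otimes> v \<in> carrier R - P" using uv P.I_prime by blast
      ultimately show "x \<otimes> y \<in> ?M" by blast
    qed
    \<comment> \<open>Exponent 0 puts the whole complement of \<open>P\<close> into
      \<open>?M\<close>.\<close>
    have "Q \<subseteq> P"
    proof
      fix x assume x: "x \<in> Q"
      hence xc: "x \<in> carrier R"
        using ideal.Icarr primeideal.axioms(1)[OF Q(1)] by metis
      show "x \<in> P"
      proof (rule ccontr)
        assume "x \<notin> P"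
        hence "a [^] (0::nat) \<otimes> x \<in> ?M" using xc by blast
        thus False using x xc Q(3) by auto
      qed
    qed
    moreover have "q \<in> Q" using cgenideal_self[OF c(2)] Q(2) by blast
    ultimately have "Q = P" using Spec1D(3)[OF P Q(1)] q(2) by blast
    \<comment> \<open>Exponent 1 puts \<open>a\<close> itself into \<open>?M\<close>, although
      \<open>a \<in> P = Q\<close>.\<close>
    moreover have "a [^] (1::nat) \<otimes> \<one> \<in> ?M" using one by blast
    ultimately show False using Q(3) a c by auto
  qed
  then obtain z where z: "z \<in> PIdl q" "z \<in> ?M" by blast
  obtain s where s: "s \<in> carrier R" "z = s \<otimes> q" using z(1) unfolding cgenideal_def by blast
  obtain n :: nat and u where "u \<in> carrier R - P" "z = a [^] n \<otimes> u" using z(2) by blast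
  thus thesis using that[of u s n] s c m_comm by simp
qed

section \<open>Subrings of a field\<close>

context
  fixes K :: "('a, 'm) ring_scheme" (structure)
  assumes field_K: "field K"
begin

interpretation field K by (rule field_K)

lemma subring_mem_carrier:
  assumes "subring A K" "x \<in> A" shows "x \<in> carrier K"
  using subringE(1)[OF assms(1)] assms(2) by blast

lemma subring_nat_pow:
  assumes A: "subring A K" "x \<in> A" shows "x [^] (n::nat) \<in> A"
  by (induction n) (use A subringE[OF A(1)] in auto)

lemma subring_domain:
  assumes "subring A K" shows "domain (K\<lparr>carrier := A\<rparr>)"
  by (rule subring_is_domain[OF assms])

text \<open>Expresses primality through the operations of \<open>K\<close> alone, so that primes of
  different subrings can be compared and intersected directly.\<close>

lemma primeideal_subring_iff:
  assumes A: "subring A K"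
  shows "primeideal P (K\<lparr>carrier := A\<rparr>) \<longleftrightarrow>
     P \<subseteq> A \<and> \<zero> \<in> P \<and> \<one> \<notin> P \<and> (\<forall>x\<in>P. \<forall>y\<in>P. x \<oplus> y \<in> P) \<and>
     (\<forall>a\<in>A. \<forall>x\<in>P. a \<otimes> x \<in> P) \<and> (\<forall>a\<in>A. \<forall>b\<in>A. a \<otimes> b \<in> P \<longrightarrow> a \<in> P \<or> b \<in> P)"
    (is "_ \<longleftrightarrow> ?R")
proof
  interpret A: domain "K\<lparr>carrier := A\<rparr>" by (rule subring_domain[OF A])
  {
    assume "primeideal P (K\<lparr>carrier := A\<rparr>)"
    then interpret P: primeideal P "K\<lparr>carrier := A\<rparr>" .
    show ?R
      using P.a_subset P.zero_closed P.a_closed P.I_l_closed P.I_prime P.I_notcarr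
        P.one_imp_carrier by simp blast
  next
    assume R: ?R
    have ac: "P \<subseteq> carrier K" using R subringE(1)[OF A] by blast
    have inv: "\<ominus>\<^bsub>K\<lparr>carrier := A\<rparr>\<^esub> x \<in> P" if x: "x \<in> P" for x
    proof -
      have xA: "x \<in> A" and xc: "x \<in> carrier K" using x R ac by auto
      \<comment> \<open>The negative taken in the subring is a product with
        \<open>\<ominus> \<one> \<in> A\<close>, so the absorption property of \<open>P\<close>
        covers it.\<close>
      have "(\<ominus> \<one>) \<otimes> x = \<ominus>\<^bsub>K\<lparr>carrier := A\<rparr>\<^esub> x"
      proof (rule A.minus_equality[symmetric])
        show "(\<ominus> \<one>) \<otimes> x \<oplus>\<^bsub>K\<lparr>carrier := A\<rparr>\<^esub> x = \<zero>\<^bsub>K\<lparr>carrier := A\<rparr>\<^esub>"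
          using xc by (simp add: l_minus l_neg)
      qed (use xA subringE[OF A] in auto)
      moreover have "(\<ominus> \<one>) \<otimes> x \<in> P" using R x subringE(3,5)[OF A] by blast
      ultimately show ?thesis by simp
    qed
    show "primeideal P (K\<lparr>carrier := A\<rparr>)"
    proof (intro primeidealI idealI A.ring_axioms A.is_cring A.add.subgroupI)
      show "P \<subseteq> carrier (K\<lparr>carrier := A\<rparr>)" "P \<noteq> {}"
        "carrier (K\<lparr>carrier := A\<rparr>) \<noteq> P"
        using R subringE(3)[OF A] by auto
      fix x assume x: "x \<in> P"
      show "\<ominus>\<^bsub>K\<lparr>carrier := A\<rparr>\<^esub> x \<in> P" by (rule inv[OF x])
      fix y
      {
        assume "y \<in> P"
        thus "x \<oplus>\<^bsub>K\<lparr>carrier := A\<rparr>\<^esub> y \<in> P" using R x by simp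
      next
        assume y: "y \<in> carrier (K\<lparr>carrier := A\<rparr>)"
        thus "y \<otimes>\<^bsub>K\<lparr>carrier := A\<rparr>\<^esub> x \<in> P" using R x by simp
        have "x \<otimes> y = y \<otimes> x"
          using x y ac subring_mem_carrier[OF A] by (intro m_comm) auto
        thus "x \<otimes>\<^bsub>K\<lparr>carrier := A\<rparr>\<^esub> y \<in> P" using R x y by simp
      }
    next
      fix a b
      assume "a \<in> carrier (K\<lparr>carrier := A\<rparr>)" "b \<in> carrier (K\<lparr>carrier := A\<rparr>)"
        "a \<otimes>\<^bsub>K\<lparr>carrier := A\<rparr>\<^esub> b \<in> P"
      thus "a \<in> P \<or> b \<in> P" using R by simp
    qed
  }
qed

lemmas primeideal_subringD = primeideal_subring_iff[THEN iffD1]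

lemma primeideal_subring_contract:
  assumes T: "subring T K" and A: "subring A K" and AT: "A \<subseteq> T"
    and Q: "primeideal Q (K\<lparr>carrier := T\<rparr>)"
  shows "primeideal (Q \<inter> A) (K\<lparr>carrier := A\<rparr>)"
proof -
  note q = primeideal_subringD[OF T Q]
  show ?thesis
    unfolding primeideal_subring_iff[OF A]
  proof (intro conjI ballI impI)
    fix a x assume ax: "a \<in> A" "x \<in> Q \<inter> A"
    hence "a \<otimes> x \<in> Q" using q AT by blast
    thus "a \<otimes> x \<in> Q \<inter> A" using ax subringE(6)[OF A] by blast
  qed (use q AT subringE(2)[OF A] subringE(7)[OF A] in blast)+
qed

text \<open>Replaces fractions by clearing denominators. The assumption
  \<open>\<zero> \<in> P\<close> makes every admissible denominator nonzero, hence invertible in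
  \<open>K\<close>.\<close>

lemma mem_localization_iff:
  assumes A: "subring A K" and P: "\<zero> \<in> P"
  shows "x \<in> localization_at K A P \<longleftrightarrow> x \<in> carrier K \<and> (\<exists>s \<in> A - P. s \<otimes> x \<in> A)"
proof
  assume "x \<in> localization_at K A P"
  then obtain a s where as: "a \<in> A" "s \<in> A - P" "x = a \<otimes> inv s"
    unfolding localization_at_def by blast
  have c: "a \<in> carrier K" "s \<in> carrier K" "s \<noteq> \<zero>"
    using as P subring_mem_carrier[OF A] by auto
  hence i: "inv s \<in> carrier K" "s \<otimes> inv s = \<one>" by (auto simp: field_Units)
  have "s \<otimes> x = (s \<otimes> inv s) \<otimes> a" using c i(1) by (simp add: as(3) m_ac)
  hence "s \<otimes> x = a" using c i by simp
  hence "s \<otimes> x \<in> A" using as(1) by simp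
  moreover have "x \<in> carrier K" using c i by (simp add: as(3))
  ultimately show "x \<in> carrier K \<and> (\<exists>s \<in> A - P. s \<otimes> x \<in> A)" using as(2) by blast
next
  assume "x \<in> carrier K \<and> (\<exists>s \<in> A - P. s \<otimes> x \<in> A)"
  then obtain s where s: "x \<in> carrier K" "s \<in> A - P" "s \<otimes> x \<in> A" by blast
  have c: "s \<in> carrier K" "s \<noteq> \<zero>" using s P subring_mem_carrier[OF A] by auto
  hence i: "inv s \<in> carrier K" "s \<otimes> inv s = \<one>" by (auto simp: field_Units)
  have "s \<otimes> x \<otimes> inv s = (s \<otimes> inv s) \<otimes> x" using c i(1) s(1) by (simp add: m_ac)
  hence "x = (s \<otimes> x) \<otimes> inv s" using s i by simp
  thus "x \<in> localization_at K A P" using s unfolding localization_at_def by blast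
qed

lemma mem_frac_field_iff:
  assumes A: "subring A K"
  shows "x \<in> frac_field K A \<longleftrightarrow> x \<in> carrier K \<and> (\<exists>s \<in> A - {\<zero>}. s \<otimes> x \<in> A)"
proof -
  have "frac_field K A = localization_at K A {\<zero>}"
    unfolding frac_field_def localization_at_def by blast
  thus ?thesis using mem_localization_iff[OF A, of "{\<zero>}"] by simp
qed

lemma Spec1_subringD:
  assumes A: "subring A K" and P: "P \<in> Spec1 (K\<lparr>carrier := A\<rparr>)"
  shows "primeideal P (K\<lparr>carrier := A\<rparr>)" and "P \<noteq> {\<zero>}"
    and "\<And>Q. primeideal Q (K\<lparr>carrier := A\<rparr>) \<Longrightarrow> Q \<subseteq> P \<Longrightarrow> Q = {\<zero>} \<or> Q = P"
  using domain.Spec1D[OF subring_domain[OF A] P] by auto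

lemma Spec1_subring_power_multiple:
  assumes A: "subring A K" and P: "P \<in> Spec1 (K\<lparr>carrier := A\<rparr>)"
    and q: "q \<in> P" "q \<noteq> \<zero>" and a: "a \<in> P"
  obtains n :: nat and u s where "u \<in> A - P" "s \<in> A" "a [^] n \<otimes> u = q \<otimes> s"
proof -
  obtain n :: nat and u s where "u \<in> carrier (K\<lparr>carrier := A\<rparr>) - P"
    "s \<in> carrier (K\<lparr>carrier := A\<rparr>)"
    "a [^]\<^bsub>K\<lparr>carrier := A\<rparr>\<^esub> n \<otimes>\<^bsub>K\<lparr>carrier := A\<rparr>\<^esub> u = q \<otimes>\<^bsub>K\<lparr>carrier := A\<rparr>\<^esub> s"
    by (rule domain.Spec1_power_multiple[OF subring_domain[OF A] P q(1) _ a]) (use q(2) in simp)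
  thus thesis using that[of u s n] by (simp add: nat_pow_consistent[symmetric])
qed

section \<open>Overrings and height one primes\<close>

text \<open>If a denominator \<open>b\<close> of \<open>x\<close> lies outside \<open>P\<close>,
  exponent 0 suffices. Otherwise some power of \<open>r\<close>, times a factor outside
  \<open>P\<close>, is a multiple of \<open>b\<close>.\<close>

lemma Spec1_power_clears_denominator:
  assumes A: "subring A K" and P: "P \<in> Spec1 (K\<lparr>carrier := A\<rparr>)"
    and x: "x \<in> frac_field K A" and r: "r \<in> P"
  obtains n :: nat where "r [^] n \<otimes> x \<in> localization_at K A P"
proof -
  note p = primeideal_subringD[OF A Spec1_subringD(1)[OF A P]]
  obtain b where b: "b \<in> A" "b \<noteq> \<zero>" "b \<otimes> x \<in> A" and x: "x \<in> carrier K"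
    using x mem_frac_field_iff[OF A] by blast
  have rc: "r \<in> carrier K" using p r subring_mem_carrier[OF A] by blast
  note loc = mem_localization_iff[OF A, of P]
  show thesis
  proof (cases "b \<in> P")
    case False
    hence "r [^] (0::nat) \<otimes> x \<in> localization_at K A P" using loc b x p by auto
    thus thesis by (rule that)
  next
    case True
    obtain n :: nat and u s where n: "u \<in> A - P" "s \<in> A" "r [^] n \<otimes> u = b \<otimes> s"
      by (rule Spec1_subring_power_multiple[OF A P True b(2) r])
    have c: "u \<in> carrier K" "s \<in> carrier K" "b \<in> carrier K"
      using n b subring_mem_carrier[OF A] by auto
    have "u \<otimes> (r [^] n \<otimes> x) = (r [^] n \<otimes> u) \<otimes> x" using c rc x by (simp add: m_ac)
    also have "\<dots> = s \<otimes> (b \<otimes> x)" unfolding n(3) using c x by (simp add: m_ac)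
    also have "\<dots> \<in> A" by (rule subringE(6)[OF A n(2) b(3)])
    finally have "r [^] n \<otimes> x \<in> localization_at K A P" using loc n rc x p by auto
    thus thesis by (rule that)
  qed
qed

lemma localization_absorb:
  assumes A: "subring A K" and P: "\<zero> \<in> P"
    and a: "a \<in> A" and x: "x \<in> localization_at K A P"
  shows "a \<otimes> x \<in> localization_at K A P"
proof -
  obtain s where s: "s \<in> A - P" "s \<otimes> x \<in> A" and x: "x \<in> carrier K"
    using x mem_localization_iff[OF A P] by blast
  have c: "a \<in> carrier K" "s \<in> carrier K" using a s subring_mem_carrier[OF A] by auto
  have "s \<otimes> (a \<otimes> x) = a \<otimes> (s \<otimes> x)" using c x by (simp add: m_ac)
  moreover have "a \<otimes> (s \<otimes> x) \<in> A" by (rule subringE(6)[OF A a s(2)])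
  ultimately have "s \<otimes> (a \<otimes> x) \<in> A" by simp
  thus ?thesis unfolding mem_localization_iff[OF A P] using c x s(1) by blast
qed

text \<open>Only the finitely many height one primes containing a fixed denominator of \<open>x\<close> have to be
  treated, each by a power of an element of \<open>M\<close>.\<close>

lemma generalized_krull_common_multiplier:
  assumes gk: "generalized_krull_domain K A" and x: "x \<in> frac_field K A"
    and M: "M \<subseteq> A" "\<one> \<in> M" "\<And>r s. r \<in> M \<Longrightarrow> s \<in> M \<Longrightarrow> r \<otimes> s \<in> M"
    and meet: "\<And>P. P \<in> Spec1 (K\<lparr>carrier := A\<rparr>) \<Longrightarrow> x \<notin> localization_at K A P \<Longrightarrow> P \<inter> M \<noteq> {}"
  obtains r where "r \<in> M" "r \<otimes> x \<in> A"
proof -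
  have A: "subring A K"
    and Aeq: "A = {x \<in> frac_field K A. \<forall>P \<in> Spec1 (K\<lparr>carrier := A\<rparr>). x \<in> localization_at K A P}"
    and fin: "\<forall>r \<in> A - {\<zero>}. finite {P \<in> Spec1 (K\<lparr>carrier := A\<rparr>). r \<in> P}"
    using gk unfolding generalized_krull_domain_def by blast+
  have zero: "\<zero> \<in> P" if "P \<in> Spec1 (K\<lparr>carrier := A\<rparr>)" for P
    using primeideal_subringD[OF A Spec1_subringD(1)[OF A that]] by blast
  obtain b where b: "b \<in> A" "b \<noteq> \<zero>" "b \<otimes> x \<in> A" and xc: "x \<in> carrier K"
    using x mem_frac_field_iff[OF A] by blast
  have Mc: "r \<in> carrier K" if "r \<in> M" for r using that M(1) subring_mem_carrier[OF A] by blast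
  have Mpow: "r [^] (n::nat) \<in> M" if "r \<in> M" for r n
    by (induction n) (use that M in auto)
  have frac_mult: "a \<otimes> x \<in> frac_field K A" if "a \<in> A" for a
  proof -
    have "b \<otimes> (a \<otimes> x) = a \<otimes> (b \<otimes> x)"
      using that b xc subring_mem_carrier[OF A] by (simp add: m_ac)
    hence "b \<otimes> (a \<otimes> x) \<in> A" using subringE(6)[OF A that b(3)] by simp
    thus ?thesis
      unfolding mem_frac_field_iff[OF A] using b that xc subring_mem_carrier[OF A] by blast
  qed
  \<comment> \<open>One multiplier serves finitely many primes: the one for \<open>F\<close> is
    multiplied by one for the new prime, and localizations absorb the extra factor.\<close>
  have "\<exists>r\<in>M. \<forall>P\<in>F. r \<otimes> x \<in> localization_at K A P"
    if "finite F" "F \<subseteq> Spec1 (K\<lparr>carrier := A\<rparr>)" for F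
    using that
  proof induction
    case empty
    thus ?case using M(2) by blast
  next
    case (insert P F)
    then obtain r where r: "r \<in> M" "\<forall>Q\<in>F. r \<otimes> x \<in> localization_at K A Q" by blast
    have "\<exists>s\<in>M. s \<otimes> (r \<otimes> x) \<in> localization_at K A P"
    proof (cases "x \<in> localization_at K A P")
      case True
      hence "\<one> \<otimes> (r \<otimes> x) \<in> localization_at K A P"
        using localization_absorb[OF A zero, of P r x] insert.prems r M xc Mc by auto
      thus ?thesis using M(2) by blast
    next
      case False
      then obtain s where s: "s \<in> P" "s \<in> M" using meet[of P] insert.prems by auto
      obtain n :: nat where "s [^] n \<otimes> (r \<otimes> x) \<in> localization_at K A P"
        by (rule Spec1_power_clears_denominator[OF A _ frac_mult s(1), of r])
          (use insert.prems r M in auto)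
      thus ?thesis using Mpow[OF s(2)] by blast
    qed
    then obtain s where s: "s \<in> M" "s \<otimes> (r \<otimes> x) \<in> localization_at K A P" by blast
    have assoc: "(s \<otimes> r) \<otimes> x = s \<otimes> (r \<otimes> x)" using Mc s r xc by (simp add: m_assoc)
    have "(s \<otimes> r) \<otimes> x \<in> localization_at K A Q" if "Q \<in> insert P F" for Q
    proof (cases "Q = P")
      case True
      thus ?thesis using s assoc by simp
    next
      case False
      hence "r \<otimes> x \<in> localization_at K A Q" "Q \<in> Spec1 (K\<lparr>carrier := A\<rparr>)"
        using that r(2) insert.prems by auto
      thus ?thesis unfolding assoc
        using localization_absorb[OF A zero] s(1) M(1) by blast
    qed
    thus ?case using M(3)[OF s(1) r(1)] by blast
  qed
  from this[OF fin[rule_format]] obtain r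
    where r: "r \<in> M" "\<forall>P\<in>{P \<in> Spec1 (K\<lparr>carrier := A\<rparr>). b \<in> P}. r \<otimes> x \<in> localization_at K A P"
    using b by auto
  \<comment> \<open>At a prime not containing \<open>b\<close>, the element \<open>b\<close> is
    itself an admissible denominator of \<open>x\<close>.\<close>
  have "r \<otimes> x \<in> localization_at K A P" if P: "P \<in> Spec1 (K\<lparr>carrier := A\<rparr>)" for P
  proof (cases "b \<in> P")
    case True
    thus ?thesis using r P by blast
  next
    case False
    hence "x \<in> localization_at K A P"
      unfolding mem_localization_iff[OF A zero[OF P]] using b xc by blast
    thus ?thesis using localization_absorb[OF A zero[OF P]] r M by blast
  qed
  hence "r \<otimes> x \<in> A" using frac_mult[of r] r(1) M(1) by (subst Aeq) blast
  thus thesis using that r(1) by blast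
qed

text \<open>Rank one valuation rings are maximal subrings of their fraction field; the element \<open>w\<close>
  moves identities from \<open>A\<close> into the smaller ring \<open>B\<close>.\<close>

lemma overring_le_localization:
  assumes A: "subring A K" and P: "P \<in> Spec1 (K\<lparr>carrier := A\<rparr>)"
    and V: "valuation_domain K (localization_at K A P)"
    and w: "w \<in> A - P" "\<forall>a\<in>A. w \<otimes> a \<in> B"
    and L: "subring L K" "B \<subseteq> L" "L \<subseteq> frac_field K A"
    and Q: "primeideal Q (K\<lparr>carrier := L\<rparr>)" "Q \<inter> B = P \<inter> B"
  shows "L \<subseteq> localization_at K A P"
    and "\<And>y b. y \<in> L \<Longrightarrow> b \<in> A - P \<Longrightarrow> b \<otimes> y \<in> P \<Longrightarrow> y \<in> Q"
proof -
  note p = primeideal_subringD[OF A Spec1_subringD(1)[OF A P]]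
  note q = primeideal_subringD[OF L(1) Q(1)]
  have loc: "x \<in> localization_at K A P \<longleftrightarrow> x \<in> carrier K \<and> (\<exists>s \<in> A - P. s \<otimes> x \<in> A)" for x
    by (rule mem_localization_iff[OF A]) (use p in blast)
  \<comment> \<open>Multiplication by \<open>w\<close> lands in \<open>B\<close>, where
    \<open>P\<close> and \<open>Q\<close> have the same trace.\<close>
  have w_P: "w \<otimes> a \<in> Q" if "a \<in> P" for a
    using that w p Q(2) by blast
  have w_notP: "w \<otimes> a \<in> L - Q" if "a \<in> A - P" for a
    using that w p Q(2) L(2) by blast
  note cA = subring_mem_carrier[OF A] and cL = subring_mem_carrier[OF L(1)]
  show "y \<in> Q" if y: "y \<in> L" "b \<in> A - P" "b \<otimes> y \<in> P" for y b
  proof -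
    have "(w \<otimes> b) \<otimes> y = w \<otimes> (b \<otimes> y)" using y w cA cL by (simp add: m_assoc)
    hence "(w \<otimes> b) \<otimes> y \<in> Q" using w_P[OF y(3)] by simp
    thus ?thesis using q w_notP[OF y(2)] y(1) by blast
  qed
  show "L \<subseteq> localization_at K A P"
  proof (rule subsetI, rule ccontr)
    fix x assume x: "x \<in> L" "x \<notin> localization_at K A P"
    have xc: "x \<in> carrier K" by (rule cL[OF x(1)])
    have x0: "x \<noteq> \<zero>"
    proof
      assume "x = \<zero>"
      hence "\<one> \<in> A - P" "\<one> \<otimes> x \<in> A" using p subringE(2,3)[OF A] by auto
      thus False using x(2) xc loc by blast
    qed
    hence ix: "inv x \<in> carrier K" "inv x \<otimes> x = \<one>" using xc by (auto simp: field_Units)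
    have sub: "subring (localization_at K A P) K" using V unfolding valuation_domain_def by blast
    obtain b where b: "b \<in> A - {\<zero>}" "b \<otimes> x \<in> A"
      using x(1) L(3) mem_frac_field_iff[OF A] by blast
    have A_loc: "A \<subseteq> localization_at K A P"
    proof
      fix a assume a: "a \<in> A"
      hence "\<one> \<otimes> a \<in> A" "\<one> \<in> A - P" using p subringE(3)[OF A] cA by auto
      thus "a \<in> localization_at K A P" using loc cA[OF a] by blast
    qed
    have "x \<in> frac_field K (localization_at K A P)"
      unfolding mem_frac_field_iff[OF sub] using A_loc b xc by blast
    hence "inv x \<in> localization_at K A P"
      using V x x0 unfolding valuation_domain_def by blast
    then obtain c where c: "c \<in> A - P" "c \<otimes> inv x \<in> A" using loc by blast
    \<comment> \<open>Thus \<open>x\<close> is the fraction \<open>c / a\<close> with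
      \<open>c\<close> outside \<open>P\<close>; since \<open>x\<close> is not in the localization,
      \<open>a\<close> must be in \<open>P\<close>.\<close>
    define a where "a = c \<otimes> inv x"
    have cc: "c \<in> carrier K" using c cA by blast
    have ac: "a \<in> carrier K" "a \<in> A" using c cA by (auto simp: a_def)
    have ax: "a \<otimes> x = c" using cc xc ix by (simp add: a_def m_assoc)
    have "a \<in> P"
    proof (rule ccontr)
      assume "a \<notin> P"
      hence "x \<in> localization_at K A P" using loc xc ac ax c by blast
      thus False using x by blast
    qed
    obtain t where t: "t \<in> P" "t \<noteq> \<zero>" using Spec1_subringD(2)[OF A P] p by blast
    have tc: "t \<in> carrier K" "w \<in> carrier K" using t p w cA by auto
    have w0: "w \<noteq> \<zero>" using w p by blast
    \<comment> \<open>The power relation is applied to \<open>w \<otimes> t\<close> instead of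
      \<open>t\<close>. Together with one further factor \<open>w\<close> this gives two copies: one
      moves \<open>s\<close> into \<open>B\<close>, the other moves \<open>t\<close> into
      \<open>Q\<close>.\<close>
    have "w \<otimes> t \<in> P" "w \<otimes> t \<noteq> \<zero>"
      using p w t tc integral[of w t] w0 by blast+
    then obtain n :: nat and u s where n: "u \<in> A - P" "s \<in> A" "a [^] n \<otimes> u = (w \<otimes> t) \<otimes> s"
      using Spec1_subring_power_multiple[OF A P _ _ \<open>a \<in> P\<close>, of "w \<otimes> t"] by metis
    have nc: "u \<in> carrier K" "s \<in> carrier K" using n cA by auto
    have cn: "c [^] n \<in> A - P"
    proof (induction n)
      case (Suc n)
      thus ?case using c(1) p subringE(6)[OF A] by simp blast
    qed (use p subringE(3)[OF A] in auto)
    \<comment> \<open>Multiplying by \<open>x [^] n\<close> turns \<open>a [^] n\<close> into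
      \<open>c [^] n\<close>, which stays outside \<open>P\<close>, while the right side falls into
      \<open>Q\<close>.\<close>
    have "w \<otimes> (c [^] n \<otimes> u) = w \<otimes> ((a [^] n \<otimes> u) \<otimes> x [^] n)"
      using ac xc nc by (simp add: ax[symmetric] nat_pow_distrib m_ac)
    also have "\<dots> = (x [^] n \<otimes> (w \<otimes> s)) \<otimes> (w \<otimes> t)"
      unfolding n(3) using tc nc xc by (simp add: m_ac)
    also have "\<dots> \<in> Q"
    proof -
      have "x [^] n \<otimes> (w \<otimes> s) \<in> L"
        using subring_nat_pow[OF L(1) x(1)] bspec[OF w(2) n(2)] L(2) subringE(6)[OF L(1)] by blast
      thus ?thesis using q w_P[OF t(1)] by blast
    qed
    finally have "w \<otimes> (c [^] n \<otimes> u) \<in> Q" .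
    moreover have "c [^] n \<otimes> u \<in> A - P" using cn n(1) p subringE(6)[OF A] by blast
    ultimately show False using w_notP by blast
  qed
qed

text \<open>A proper ideal lies in some maximal ideal, hence in \<open>m\<close>. The principal
  ideal of an element outside \<open>m\<close> therefore contains \<open>\<one>\<close>; its inverse
  in \<open>L\<close> is the inverse in \<open>K\<close>.\<close>

lemma local_ring_obtain_maximal:
  assumes L: "subring L K" and loc: "local_ring (K\<lparr>carrier := L\<rparr>)"
  obtains m where "primeideal m (K\<lparr>carrier := L\<rparr>)"
    "\<And>Q. primeideal Q (K\<lparr>carrier := L\<rparr>) \<Longrightarrow> Q \<subseteq> m"
    "\<And>x. x \<in> L - m \<Longrightarrow> inv x \<in> L"
proof -
  interpret L: domain "K\<lparr>carrier := L\<rparr>" by (rule subring_domain[OF L])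
  obtain m where m: "maximalideal m (K\<lparr>carrier := L\<rparr>)"
    and uniq: "\<And>n. maximalideal n (K\<lparr>carrier := L\<rparr>) \<Longrightarrow> n = m"
    using loc unfolding local_ring_def by blast
  have le: "I \<subseteq> m" if I: "ideal I (K\<lparr>carrier := L\<rparr>)" "\<one> \<notin> I" for I
    using L.exists_maximalideal[OF I(1)] I(2) uniq by auto
  show thesis
  proof (rule that)
    show "primeideal m (K\<lparr>carrier := L\<rparr>)" by (rule L.maximalideal_prime[OF m])
    fix Q assume "primeideal Q (K\<lparr>carrier := L\<rparr>)"
    thus "Q \<subseteq> m" using le primeideal.axioms(1) primeideal_subringD[OF L] by blast
  next
    fix x assume x: "x \<in> L - m"
    have "ideal (PIdl\<^bsub>K\<lparr>carrier := L\<rparr>\<^esub> x) (K\<lparr>carrier := L\<rparr>)"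
      "x \<in> PIdl\<^bsub>K\<lparr>carrier := L\<rparr>\<^esub> x"
      using L.cgenideal_ideal L.cgenideal_self x by auto
    hence "\<one> \<in> PIdl\<^bsub>K\<lparr>carrier := L\<rparr>\<^esub> x" using le x by blast
    then obtain y where y: "y \<in> L" "y \<otimes> x = \<one>" unfolding cgenideal_def by auto
    hence "inv x = y" using x subring_mem_carrier[OF L] m_comm[of x y] by (intro comm_inv_char) auto
    thus "inv x \<in> L" using y by simp
  qed
qed

section \<open>The pullback\<close>

text \<open>The theorem in terms of elements instead of cosets: \<open>R\<close> is
  \<open>J + k\<close>, and \<open>lift_unit\<close> records that an element of \<open>S\<close>
  invertible modulo \<open>J\<close> is congruent to an element of \<open>k\<close>.\<close>

lemma perinormal_pullback:
  assumes gk: "generalized_krull_domain K S"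
    and J: "J \<in> Spec1 (K\<lparr>carrier := S\<rparr>)"
    and t: "t \<in> S" "J = {s \<otimes> t | s. s \<in> S}"
    and k: "subring k K" "k \<subseteq> S" "\<And>a. a \<in> k \<Longrightarrow> a \<noteq> \<zero> \<Longrightarrow> \<exists>b\<in>k. b \<otimes> a = \<one>"
    and R: "R = {j \<oplus> a | j a. j \<in> J \<and> a \<in> k}"
    and lift_unit: "\<And>y s j. y \<in> S \<Longrightarrow> s \<in> S \<Longrightarrow> j \<in> J \<Longrightarrow> s \<otimes> y = j \<oplus> \<one> \<Longrightarrow> y \<in> R"
  shows "perinormal K R"
proof -
  have S: "subring S K"
    and val: "\<And>P. P \<in> Spec1 (K\<lparr>carrier := S\<rparr>) \<Longrightarrow> valuation_domain K (localization_at K S P)"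
    using gk unfolding generalized_krull_domain_def by blast+
  note primeS = primeideal_subringD[OF S Spec1_subringD(1)[OF S]]
  note Sc = subring_mem_carrier[OF S]
  note pJ = primeS[OF J]

  \<comment> \<open>The ring \<open>J + k\<close> and its ideal \<open>J\<close>\<close>
  have JS: "J \<subseteq> S" using pJ by blast
  have Jc: "j \<in> carrier K" if "j \<in> J" for j using that JS Sc by blast
  have Jmult: "s \<otimes> j \<in> J" if "s \<in> S" "j \<in> J" for s j using that pJ by blast
  have Jadd: "i \<oplus> j \<in> J" if "i \<in> J" "j \<in> J" for i j using that pJ by blast
  have Jneg: "\<ominus> j \<in> J" if "j \<in> J" for j
  proof -
    have "(\<ominus> \<one>) \<otimes> j = \<ominus> j" using Jc[OF that] by (simp add: l_minus)
    moreover have "(\<ominus> \<one>) \<otimes> j \<in> J" using pJ that subringE(3,5)[OF S] by blast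
    ultimately show ?thesis by simp
  qed
  have kc: "a \<in> carrier K" if "a \<in> k" for a using that k(2) Sc by blast
  have JR: "J \<subseteq> R"
  proof
    fix j assume "j \<in> J"
    moreover have "j = j \<oplus> \<zero>" using Jc[OF \<open>j \<in> J\<close>] by simp
    ultimately show "j \<in> R" unfolding R using subringE(2)[OF k(1)] by blast
  qed
  have RS: "R \<subseteq> S" unfolding R using JS k(2) subringE(7)[OF S] by blast
  have subR: "subring R K"
  proof (rule subringI)
    show "R \<subseteq> carrier K" using RS Sc by blast
    have "\<one> = \<zero> \<oplus> \<one>" by simp
    thus "\<one> \<in> R" unfolding R using pJ subringE(3)[OF k(1)] by blast
    fix x assume "x \<in> R"
    then obtain i a where x: "x = i \<oplus> a" "i \<in> J" "a \<in> k" unfolding R by blast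
    have "\<ominus> x = (\<ominus> i) \<oplus> (\<ominus> a)" unfolding x(1) using x kc Jc by (simp add: minus_add)
    thus "\<ominus> x \<in> R" unfolding R using Jneg[OF x(2)] subringE(5)[OF k(1) x(3)] by blast
    fix y assume "y \<in> R"
    then obtain j b where y: "y = j \<oplus> b" "j \<in> J" "b \<in> k" unfolding R by blast
    have c: "i \<in> carrier K" "j \<in> carrier K" "a \<in> carrier K" "b \<in> carrier K"
      using x y Jc kc by auto
    have "x \<oplus> y = (i \<oplus> j) \<oplus> (a \<oplus> b)" using c unfolding x y by algebra
    thus "x \<oplus> y \<in> R" unfolding R using Jadd[OF x(2) y(2)] subringE(7)[OF k(1) x(3) y(3)] by blast
    have "x \<otimes> y = (y \<otimes> i \<oplus> a \<otimes> j) \<oplus> a \<otimes> b" using c unfolding x y by algebra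
    moreover have "y \<otimes> i \<oplus> a \<otimes> j \<in> J"
      by (intro Jadd Jmult) (use x y k(2) RS \<open>y \<in> R\<close> in auto)
    ultimately show "x \<otimes> y \<in> R" unfolding R using subringE(6)[OF k(1) x(3) y(3)] by blast
  qed
  note Rc = subring_mem_carrier[OF subR]
  \<comment> \<open>\<open>R\<close> is \<open>J + k\<close> with \<open>k\<close> a field:
    subtracting the \<open>J\<close>-part of an element of \<open>P\<close> leaves an element of
    \<open>k\<close> in \<open>P\<close>, which is zero because it cannot be a unit.\<close>
  have J_max: "P = J" if P: "primeideal P (K\<lparr>carrier := R\<rparr>)" "J \<subseteq> P" for P
  proof
    note p = primeideal_subringD[OF subR P(1)]
    show "P \<subseteq> J"
    proof
      fix r assume r: "r \<in> P"
      then obtain j a where ja: "r = j \<oplus> a" "j \<in> J" "a \<in> k" using p unfolding R by blast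
      have c: "j \<in> carrier K" "a \<in> carrier K" using ja Jc kc by auto
      have "r \<oplus> (\<ominus> j) \<in> P" using r Jneg[OF ja(2)] P(2) p by blast
      moreover have "r \<oplus> (\<ominus> j) = a" using c unfolding ja(1) by algebra
      ultimately have aP: "a \<in> P" by simp
      have "a = \<zero>"
      proof (rule ccontr)
        assume "a \<noteq> \<zero>"
        then obtain b where b: "b \<in> k" "b \<otimes> a = \<one>" using k(3) ja(3) by blast
        have "b = \<zero> \<oplus> b" using kc[OF b(1)] by simp
        hence "b \<in> R" unfolding R using b(1) pJ by blast
        hence "b \<otimes> a \<in> P" using p aP by blast
        thus False using b(2) p by simp
      qed
      thus "r \<in> J" using ja c by simp
    qed
  qed (rule P(2))
  \<comment> \<open>Modulo \<open>J\<close> the product \<open>s \<otimes> y\<close> is a nonzero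
    constant \<open>a\<close>; scaling by its inverse \<open>b\<close> exhibits \<open>y\<close> as
    a unit modulo \<open>J\<close>.\<close>
  have unit_mod_J: "y \<in> R" if ys: "y \<in> S" "s \<in> S" "s \<otimes> y \<in> R - J" for y s
  proof -
    obtain j a where ja: "s \<otimes> y = j \<oplus> a" "j \<in> J" "a \<in> k" using ys(3) unfolding R by blast
    have "a \<noteq> \<zero>" using ys(3) ja Jc by auto
    then obtain b where b: "b \<in> k" "b \<otimes> a = \<one>" using k(3) ja(3) by blast
    have c: "s \<in> carrier K" "y \<in> carrier K" "b \<in> carrier K" "j \<in> carrier K" "a \<in> carrier K"
      using ys Sc kc b ja Jc by auto
    have "(b \<otimes> s) \<otimes> y = b \<otimes> (s \<otimes> y)" using c by (simp add: m_assoc)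
    also have "\<dots> = b \<otimes> j \<oplus> \<one>" unfolding ja(1) b(2)[symmetric] using c by (simp add: r_distr)
    finally have "(b \<otimes> s) \<otimes> y = b \<otimes> j \<oplus> \<one>" .
    moreover have "b \<otimes> s \<in> S" "b \<otimes> j \<in> J"
      using b(1) k(2) ys(2) subringE(6)[OF S] Jmult ja(2) by blast+
    ultimately show ?thesis using lift_unit[OF ys(1)] by blast
  qed
  have tJ: "t \<in> J"
  proof -
    have "t = \<one> \<otimes> t" using Sc t(1) by simp
    thus ?thesis unfolding t(2) using subringE(3)[OF S] by blast
  qed
  \<comment> \<open>This and \<open>t_notin\<close> let \<open>t\<close> play the role of
    \<open>w\<close> in \<open>overring_le_localization\<close>, with \<open>R\<close> as the
    smaller ring.\<close>
  have t_mult: "\<forall>s\<in>S. t \<otimes> s \<in> R"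
  proof
    fix s assume s: "s \<in> S"
    have "t \<otimes> s = s \<otimes> t" using s t(1) Sc by (simp add: m_comm)
    thus "t \<otimes> s \<in> R" using s t(2) JR by auto
  qed
  have t_notin: "t \<in> S - P" if P: "P \<in> Spec1 (K\<lparr>carrier := S\<rparr>)" "P \<noteq> J" for P
  proof -
    have "t \<notin> P"
    proof
      assume "t \<in> P"
      hence "J \<subseteq> P" unfolding t(2) using primeS[OF P(1)] by blast
      thus False
        using Spec1_subringD(3)[OF S P(1) Spec1_subringD(1)[OF S J]] Spec1_subringD(2)[OF S J] P(2)
        by blast
    qed
    thus ?thesis using t(1) by blast
  qed

  \<comment> \<open>Local overrings with going-down\<close>
  show ?thesis
    unfolding perinormal_def
  proof (intro conjI allI impI subR)
    fix L
    assume L: "overring K R L" and loc: "local_ring (K\<lparr>carrier := L\<rparr>)"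
      and gd: "going_down (K\<lparr>carrier := R\<rparr>) (K\<lparr>carrier := L\<rparr>)"
    have subL: "subring L K" and RL: "R \<subseteq> L" and LF: "L \<subseteq> frac_field K R"
      using L unfolding overring_def by auto
    note Lc = subring_mem_carrier[OF subL]
    have LFS: "L \<subseteq> frac_field K S"
      using LF RS mem_frac_field_iff[OF subR] mem_frac_field_iff[OF S] by blast
    obtain m where m: "primeideal m (K\<lparr>carrier := L\<rparr>)"
      and m_le: "\<And>Q. primeideal Q (K\<lparr>carrier := L\<rparr>) \<Longrightarrow> Q \<subseteq> m"
      and m_inv: "\<And>x. x \<in> L - m \<Longrightarrow> inv x \<in> L"
      using local_ring_obtain_maximal[OF subL loc] by metis
    note pm = primeideal_subringD[OF subL m]
    define p where "p = m \<inter> R"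
    have p: "primeideal p (K\<lparr>carrier := R\<rparr>)"
      unfolding p_def by (rule primeideal_subring_contract[OF subL subR RL m])
    note pp = primeideal_subringD[OF subR p]
    have zero_p: "\<zero> \<in> p" using pp by blast
    \<comment> \<open>Going-down enters here, applied to \<open>P \<inter> R \<subseteq> p\<close>
      and the prime \<open>m\<close> over \<open>p\<close>; the resulting \<open>Q\<close> has the
      same trace on \<open>R\<close> as \<open>P\<close>.\<close>
    have good: "L \<subseteq> localization_at K S P" "\<And>y. y \<in> L \<Longrightarrow> y \<in> P \<Longrightarrow> y \<in> m"
      if P: "P \<in> Spec1 (K\<lparr>carrier := S\<rparr>)" "P \<noteq> J" "P \<inter> R \<subseteq> p" for P
    proof -
      have PR: "primeideal (P \<inter> R) (K\<lparr>carrier := R\<rparr>)"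
        by (rule primeideal_subring_contract[OF S subR RS Spec1_subringD(1)[OF S P(1)]])
      have "m \<inter> carrier (K\<lparr>carrier := R\<rparr>) = p" by (simp add: p_def)
      from gd[unfolded going_down_def, rule_format, OF PR p P(3) m this]
      obtain Q where Q: "primeideal Q (K\<lparr>carrier := L\<rparr>)" "Q \<inter> R = P \<inter> R" by auto
      note o = overring_le_localization[OF S P(1) val[OF P(1)] t_notin[OF P(1,2)] t_mult subL RL LFS Q]
      show "L \<subseteq> localization_at K S P" by (rule o(1))
      fix y assume y: "y \<in> L" "y \<in> P"
      have "\<one> \<in> S - P" "\<one> \<otimes> y \<in> P" using primeS[OF P(1)] subringE(3)[OF S] y Lc by auto
      thus "y \<in> m" using o(2)[OF y(1)] m_le[OF Q(1)] by blast
    qed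
    have "L = localization_at K R p"
    proof
      \<comment> \<open>Elements of \<open>R - p\<close> lie outside \<open>m\<close>, so they are
        units of \<open>L\<close>.\<close>
      show "localization_at K R p \<subseteq> L"
      proof
        fix x assume "x \<in> localization_at K R p"
        then obtain s where s: "s \<in> R - p" "s \<otimes> x \<in> R" and x: "x \<in> carrier K"
          using mem_localization_iff[OF subR zero_p] by blast
        have i: "inv s \<in> L" using s RL m_inv unfolding p_def by blast
        have c: "s \<in> carrier K" "s \<noteq> \<zero>" using s Rc zero_p by auto
        have "inv s \<otimes> (s \<otimes> x) = (inv s \<otimes> s) \<otimes> x" using c x Lc[OF i] by (simp add: m_assoc)
        also have "\<dots> = x" using c x by (simp add: field_Units)
        finally have "inv s \<otimes> (s \<otimes> x) = x" .
        moreover have "inv s \<otimes> (s \<otimes> x) \<in> L" using i s(2) RL subringE(6)[OF subL] by blast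
        ultimately show "x \<in> L" by simp
      qed
      show "L \<subseteq> localization_at K R p"
      proof
        fix x assume x: "x \<in> L"
        have xc: "x \<in> carrier K" by (rule Lc[OF x])
        have xF: "x \<in> frac_field K S" using x LFS by blast
        have one_p: "\<one> \<in> R - p" using pp subringE(3)[OF subR] by blast
        have p_mult: "r \<otimes> s \<in> R - p" if "r \<in> R - p" "s \<in> R - p" for r s
          using that pp subringE(6)[OF subR] by blast
        show "x \<in> localization_at K R p"
        proof (cases "J \<subseteq> p")
          \<comment> \<open>The multiplier comes from \<open>R - p\<close>: the prime
            \<open>J\<close> meets this set in \<open>g\<close>, and by \<open>good\<close> so does
            every other height one prime whose localization omits \<open>x\<close>. A final factor
            \<open>g\<close> moves the product from \<open>S\<close> into \<open>J\<close>.\<close>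
          case False
          then obtain g where g: "g \<in> J" "g \<notin> p" by blast
          obtain r where r: "r \<in> R - p" "r \<otimes> x \<in> S"
          proof (rule generalized_krull_common_multiplier[OF gk xF _ one_p p_mult])
            show "R - p \<subseteq> S" using RS by blast
            fix P assume P: "P \<in> Spec1 (K\<lparr>carrier := S\<rparr>)" "x \<notin> localization_at K S P"
            show "P \<inter> (R - p) \<noteq> {}"
            proof (cases "P = J")
              case True
              thus ?thesis using g JR by blast
            next
              case False
              thus ?thesis using good(1)[OF P(1) False] P(2) x by blast
            qed
          qed auto
          have gR: "g \<in> R - p" using g JR by blast
          have "g \<otimes> (r \<otimes> x) = (r \<otimes> x) \<otimes> g" using g(1) Jc r Sc by (simp add: m_comm)
          moreover have "(r \<otimes> x) \<otimes> g \<in> J" by (rule Jmult[OF r(2) g(1)])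
          ultimately have "g \<otimes> (r \<otimes> x) \<in> R" using JR by auto
          moreover have "g \<otimes> (r \<otimes> x) = (g \<otimes> r) \<otimes> x"
            using g(1) Jc r Rc xc by (simp add: m_assoc)
          ultimately show ?thesis
            unfolding mem_localization_iff[OF subR zero_p] using p_mult[OF gR r(1)] xc by auto
        next
          case True
          hence pJ_eq: "p = J" by (rule J_max[OF p])
          \<comment> \<open>The multiplier lemma is applied to \<open>inv y\<close>. A height one
            prime whose localization omits \<open>inv y\<close> contains \<open>y\<close>, so it
            differs from \<open>J\<close>, and by \<open>good\<close> it meets \<open>R - p\<close>,
            since otherwise \<open>y \<in> m\<close>.\<close>
          have unit: "y \<in> R" if y: "y \<in> L" "y \<in> S" "y \<notin> m" for y
          proof (cases "y \<in> J")
            case True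
            thus ?thesis using JR by blast
          next
            case False
            have y0: "y \<noteq> \<zero>" using y pm by blast
            have yc: "y \<in> carrier K" by (rule Sc[OF y(2)])
            have i: "inv y \<in> carrier K" "y \<otimes> inv y = \<one>" using y0 yc by (auto simp: field_Units)
            have yi: "y \<otimes> inv y \<in> S" using i(2) subringE(3)[OF S] by simp
            have iF: "inv y \<in> frac_field K S"
              unfolding mem_frac_field_iff[OF S] using i(1) y(2) y0 yi by blast
            obtain r where r: "r \<in> R - p" "r \<otimes> inv y \<in> S"
            proof (rule generalized_krull_common_multiplier[OF gk iF _ one_p p_mult])
              show "R - p \<subseteq> S" using RS by blast
              fix P assume P: "P \<in> Spec1 (K\<lparr>carrier := S\<rparr>)" "inv y \<notin> localization_at K S P"
              have "\<zero> \<in> P" using primeS[OF P(1)] by blast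
              hence yP: "y \<in> P"
                using P(2) i(1) y(2) yi mem_localization_iff[OF S, of P "inv y"] by blast
              hence "P \<noteq> J" using False by blast
              thus "P \<inter> (R - p) \<noteq> {}" using good(2)[OF P(1) _ _ y(1) yP] y(3) by blast
            qed auto
            have "(r \<otimes> inv y) \<otimes> y = r \<otimes> (y \<otimes> inv y)" using yc i(1) r Rc by (simp add: m_ac)
            hence "(r \<otimes> inv y) \<otimes> y = r" using i r Rc by simp
            thus ?thesis using unit_mod_J[OF y(2) r(2)] r(1) pJ_eq by simp
          qed
          have LS: "y \<in> R" if y: "y \<in> L" "y \<in> S" for y
          proof (cases "y \<in> m")
            case True
            have yc: "y \<in> carrier K" by (rule Sc[OF y(2)])
            \<comment> \<open>For \<open>y \<in> m\<close> the previous fact is applied to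
              \<open>\<one> \<oplus> y\<close> instead.\<close>
            have "\<one> \<oplus> y \<notin> m"
            proof
              assume "\<one> \<oplus> y \<in> m"
              moreover have "(\<ominus> \<one>) \<otimes> y \<in> m" using True pm subringE(3,5)[OF subL] by blast
              ultimately have "(\<one> \<oplus> y) \<oplus> (\<ominus> \<one>) \<otimes> y \<in> m" using pm by blast
              moreover have "(\<one> \<oplus> y) \<oplus> (\<ominus> \<one>) \<otimes> y = \<one>" using yc by algebra
              ultimately show False using pm by simp
            qed
            hence "\<one> \<oplus> y \<in> R"
              using unit y subringE(3,7)[OF subL] subringE(3,7)[OF S] by blast
            hence "(\<one> \<oplus> y) \<oplus> (\<ominus> \<one>) \<in> R" using subringE(3,5,7)[OF subR] by blast
            moreover have "(\<one> \<oplus> y) \<oplus> (\<ominus> \<one>) = y" using yc by algebra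
            ultimately show ?thesis by simp
          qed (use unit y in blast)
          \<comment> \<open>As \<open>p = J\<close>, the set \<open>R - p\<close> is disjoint from
            \<open>J\<close>; powers of \<open>t\<close> are adjoined so that \<open>J\<close> is
            met too.\<close>
          let ?M = "{r \<otimes> t [^] n | r (n::nat). r \<in> R - p}"
          have tc: "t \<in> carrier K" by (rule Sc[OF t(1)])
          have tL: "t \<in> L" using tJ JR RL by blast
          obtain z where z: "z \<in> ?M" "z \<otimes> x \<in> S"
          proof (rule generalized_krull_common_multiplier[OF gk xF, of ?M])
            show "?M \<subseteq> S"
              using RS subring_nat_pow[OF S t(1)] subringE(6)[OF S] by blast
            have "\<one> = \<one> \<otimes> t [^] (0::nat)" by simp
            thus "\<one> \<in> ?M" using one_p by blast
          next
            fix u v assume "u \<in> ?M" "v \<in> ?M"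
            then obtain r n s l where rs: "u = r \<otimes> t [^] (n::nat)" "v = s \<otimes> t [^] (l::nat)"
              "r \<in> R - p" "s \<in> R - p" by blast
            have "u \<otimes> v = (r \<otimes> s) \<otimes> t [^] (n + l)"
              using rs Rc tc by (simp add: nat_pow_mult[symmetric] m_ac)
            thus "u \<otimes> v \<in> ?M" using p_mult[OF rs(3,4)] by blast
          next
            fix P assume P: "P \<in> Spec1 (K\<lparr>carrier := S\<rparr>)" "x \<notin> localization_at K S P"
            show "P \<inter> ?M \<noteq> {}"
            proof (cases "P = J")
              case True
              have "t = \<one> \<otimes> t [^] (1::nat)" using tc by simp
              hence "t \<in> ?M" using one_p by blast
              thus ?thesis using tJ True by blast
            next
              case False
              then obtain r where r: "r \<in> P" "r \<in> R - p" using good(1)[OF P(1) False] P(2) x by blast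
              hence "r = r \<otimes> t [^] (0::nat)" using Rc by simp
              hence "r \<in> ?M" using r(2) by blast
              thus ?thesis using r(1) by blast
            qed
          qed
          obtain r and n :: nat where r: "r \<in> R - p" "z = r \<otimes> t [^] n" using z(1) by blast
          have rc: "r \<in> carrier K" using r Rc by blast
          define y where "y = r \<otimes> x"
          have yL: "y \<in> L" using r x RL subringE(6)[OF subL] unfolding y_def by blast
          have yc: "y \<in> carrier K" by (rule Lc[OF yL])
          have "z \<otimes> x = t [^] n \<otimes> y" using tc rc xc by (simp add: r(2) y_def m_ac)
          hence ex: "\<exists>n::nat. t [^] n \<otimes> y \<in> S" using z(2) by metis
          \<comment> \<open>\<open>l\<close> measures the pole of \<open>y = r \<otimes> x\<close>
            along \<open>J\<close>. Once \<open>l = 0\<close> is known, \<open>y\<close> lies in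
            \<open>L \<inter> S\<close>, hence in \<open>R\<close>, and \<open>r\<close> is a
            denominator of \<open>x\<close> outside \<open>p\<close>.\<close>
          define l where "l = (LEAST n::nat. t [^] n \<otimes> y \<in> S)"
          have l: "t [^] l \<otimes> y \<in> S" unfolding l_def by (rule LeastI_ex[OF ex])
          have "l = 0"
          proof (rule ccontr)
            assume "l \<noteq> 0"
            then obtain i where i: "l = Suc i" by (cases l) auto
            \<comment> \<open>One power of \<open>t\<close> short of \<open>S\<close>. But
              \<open>v \<otimes> t\<close> lies in \<open>m \<inter> R = J\<close>, and cancelling
              \<open>t\<close> puts \<open>v\<close> into \<open>S\<close>.\<close>
            define v where "v = t [^] i \<otimes> y"
            have vL: "v \<in> L" unfolding v_def
              by (intro subringE(6)[OF subL] subring_nat_pow[OF subL tL] yL)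
            have vc: "v \<in> carrier K" by (rule Lc[OF vL])
            have tv: "t [^] l \<otimes> y = v \<otimes> t" using tc yc by (simp add: v_def i m_ac)
            have "t \<in> m" using tJ pJ_eq p_def by blast
            hence "v \<otimes> t \<in> m" using pm vL by blast
            moreover have "v \<otimes> t \<in> R" using LS l tv vL tL subringE(6)[OF subL] by metis
            ultimately have "v \<otimes> t \<in> J" using pJ_eq p_def by blast
            then obtain s where s: "s \<in> S" "v \<otimes> t = s \<otimes> t" using t(2) by blast
            have "t \<noteq> \<zero>"
            proof
              assume "t = \<zero>"
              hence "J \<subseteq> {\<zero>}" using t(2) Sc by auto
              thus False using Spec1_subringD(2)[OF S J] pJ by blast
            qed
            hence "v = s" using s tc vc Sc m_rcancel by blast
            hence "t [^] i \<otimes> y \<in> S" using s v_def by simp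
            hence "l \<le> i" unfolding l_def by (rule Least_le)
            thus False using i by simp
          qed
          hence "y \<in> S" using l yc by simp
          hence "y \<in> R" by (rule LS[OF yL])
          thus ?thesis
            unfolding mem_localization_iff[OF subR zero_p] using r(1) xc y_def by blast
        qed
      qed
    qed
    thus "\<exists>P. primeideal P (K\<lparr>carrier := R\<rparr>) \<and> L = localization_at K R P" using p by blast
  qed
qed

end

section \<open>Passage from cosets to elements\<close>

theorem theorem4p2:
  fixes K :: "('a, 'm) ring_scheme" and S k J R :: "'a set"
  assumes "field K"
    and "generalized_krull_domain K S"
    and "krull_dim (K\<lparr>carrier := S\<rparr>) > 1"
    and "k = Units (K\<lparr>carrier := S\<rparr>) \<union> {\<zero>\<^bsub>K\<^esub>}"
    and "subfield k (K\<lparr>carrier := S\<rparr>)"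
    and "principalideal J (K\<lparr>carrier := S\<rparr>)"
    and "J \<in> Spec1 (K\<lparr>carrier := S\<rparr>)"
    and "\<not> maximalideal J (K\<lparr>carrier := S\<rparr>)"
    and "Units (K\<lparr>carrier := S\<rparr> Quot J) \<subseteq> (\<lambda>a. J +>\<^bsub>K\<lparr>carrier := S\<rparr>\<^esub> a) ` k"
    and "R = {s \<in> S. J +>\<^bsub>K\<lparr>carrier := S\<rparr>\<^esub> s \<in> (\<lambda>a. J +>\<^bsub>K\<lparr>carrier := S\<rparr>\<^esub> a) ` k}"
  shows "perinormal K R"
proof -
  let ?S = "K\<lparr>carrier := S\<rparr>"
  interpret field K by fact
  have S: "subring S K" using assms(2) unfolding generalized_krull_domain_def by blast
  interpret S: domain ?S by (rule subring_is_domain[OF S])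
  interpret J: principalideal J ?S by fact
  note k = subringE[OF subfieldE(1)[OF assms(5)], simplified]
  have coset: "J +>\<^bsub>?S\<^esub> a = {j \<oplus>\<^bsub>K\<^esub> a | j. j \<in> J}" for a
    unfolding a_r_coset_def' by auto
  have coset_eq: "J +>\<^bsub>?S\<^esub> x = J +>\<^bsub>?S\<^esub> a \<longleftrightarrow> (\<exists>j\<in>J. x = j \<oplus>\<^bsub>K\<^esub> a)" if "x \<in> S" "a \<in> S" for x a
  proof
    assume eq: "J +>\<^bsub>?S\<^esub> x = J +>\<^bsub>?S\<^esub> a"
    have "x = \<zero>\<^bsub>K\<^esub> \<oplus>\<^bsub>K\<^esub> x" using that S.l_zero[of x] by simp
    hence "x \<in> J +>\<^bsub>?S\<^esub> x" using J.zero_closed unfolding coset by auto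
    hence "x \<in> J +>\<^bsub>?S\<^esub> a" by (simp only: eq)
    thus "\<exists>j\<in>J. x = j \<oplus>\<^bsub>K\<^esub> a" unfolding coset by blast
  next
    assume "\<exists>j\<in>J. x = j \<oplus>\<^bsub>K\<^esub> a"
    hence "x \<in> J +>\<^bsub>?S\<^esub> a" unfolding coset by blast
    thus "J +>\<^bsub>?S\<^esub> x = J +>\<^bsub>?S\<^esub> a"
      using S.a_repr_independence[OF _ _ J.a_subgroup] that by simp
  qed
  obtain t where t: "t \<in> S" "J = {s \<otimes>\<^bsub>K\<^esub> t | s. s \<in> S}"
  proof -
    obtain t where "t \<in> S" "J = PIdl\<^bsub>?S\<^esub> t"
      using J.generate S.cgenideal_eq_genideal by auto
    thus thesis using that unfolding cgenideal_def by simp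
  qed
  have R_iff: "x \<in> R \<longleftrightarrow> x \<in> S \<and> (\<exists>a\<in>k. J +>\<^bsub>?S\<^esub> x = J +>\<^bsub>?S\<^esub> a)" for x
    unfolding assms(10) by auto
  have R: "R = {j \<oplus>\<^bsub>K\<^esub> a | j a. j \<in> J \<and> a \<in> k}"
  proof -
    have "j \<oplus>\<^bsub>K\<^esub> a \<in> S" if "j \<in> J" "a \<in> k" for j a
      using that J.Icarr[of j] k(1) S.a_closed[of j a] by auto
    thus ?thesis using coset_eq k(1) by (auto simp: R_iff) blast+
  qed
  show ?thesis
  proof (rule perinormal_pullback[OF assms(1,2,7) t _ _ _ R])
    show "subring k K"
    proof (rule subringI)
      show "k \<subseteq> carrier K" using k(1) subringE(1)[OF S] by blast
      fix a assume a: "a \<in> k"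
      \<comment> \<open>\<open>k\<close> is given as a subfield of \<open>S\<close>, so its
        negatives have to be identified with those of \<open>K\<close>.\<close>
      have "\<ominus>\<^bsub>?S\<^esub> a = \<ominus>\<^bsub>K\<^esub> a"
      proof (rule S.minus_equality)
        have "a \<in> carrier K" using a k(1) subringE(1)[OF S] by blast
        thus "\<ominus>\<^bsub>K\<^esub> a \<oplus>\<^bsub>?S\<^esub> a = \<zero>\<^bsub>?S\<^esub>" by (simp add: l_neg)
      qed (use a k(1) subringE(5)[OF S] in auto)
      thus "\<ominus>\<^bsub>K\<^esub> a \<in> k" using k(5)[OF a] by simp
    qed (use k in auto)
    show "k \<subseteq> S" by (rule k(1))
    show "\<exists>b\<in>k. b \<otimes>\<^bsub>K\<^esub> a = \<one>\<^bsub>K\<^esub>" if "a \<in> k" "a \<noteq> \<zero>\<^bsub>K\<^esub>" for a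
    proof -
      \<comment> \<open>The inverse of a unit of \<open>S\<close> is again a unit of
        \<open>S\<close>, hence again in \<open>k\<close>.\<close>
      have "a \<in> Units ?S" using that assms(4) by blast
      hence "inv\<^bsub>?S\<^esub> a \<in> Units ?S" "inv\<^bsub>?S\<^esub> a \<otimes>\<^bsub>K\<^esub> a = \<one>\<^bsub>K\<^esub>"
        using S.Units_inv_Units S.Units_l_inv[of a] by auto
      thus ?thesis using assms(4) by blast
    qed
    \<comment> \<open>The equation makes the coset of \<open>y\<close> a unit of the quotient with
      inverse the coset of \<open>s\<close>, so by hypothesis it is the coset of an element of
      \<open>k\<close>.\<close>
    fix y s j assume y: "y \<in> S" and s: "s \<in> S" and j: "j \<in> J" "s \<otimes>\<^bsub>K\<^esub> y = j \<oplus>\<^bsub>K\<^esub> \<one>\<^bsub>K\<^esub>"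
    interpret Q: cring "?S Quot J" by (rule J.quotient_is_cring[OF S.is_cring])
    have "J +>\<^bsub>?S\<^esub> (s \<otimes>\<^bsub>K\<^esub> y) = J +>\<^bsub>?S\<^esub> \<one>\<^bsub>K\<^esub>"
      using coset_eq[of "s \<otimes>\<^bsub>K\<^esub> y" "\<one>\<^bsub>K\<^esub>"] j y s subringE(3,6)[OF S] by blast
    hence "(J +>\<^bsub>?S\<^esub> s) \<otimes>\<^bsub>?S Quot J\<^esub> (J +>\<^bsub>?S\<^esub> y) = \<one>\<^bsub>?S Quot J\<^esub>"
      using J.rcoset_mult_add[of s y] y s by (simp add: FactRing_def)
    moreover have "J +>\<^bsub>?S\<^esub> s \<in> carrier (?S Quot J)" "J +>\<^bsub>?S\<^esub> y \<in> carrier (?S Quot J)"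
      using y s S.a_rcosetsI[OF J.a_subset] by (auto simp: FactRing_def)
    ultimately have "J +>\<^bsub>?S\<^esub> y \<in> Units (?S Quot J)"
      unfolding Units_def using Q.m_comm by auto
    thus "y \<in> R" unfolding R_iff using y assms(9) by auto
  qed
qed

end
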